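(* Let $m,n,K\ge 1$, let $\{B_0,\dots,B_{K-1}\}$ be a partition of $\mathbb{R}$ into pairwise disjoint measurable sets, and let $A_1,\dots,A_m\in\mathbb{R}^n$. For each $j\in[m]$, $$\|A_j\|_1=\sum_{S\ni j}\widetilde{N}(S),$$ where the sum is over all coalitions $S\subseteq[m]$ containing $j$. Furthermore, $\widetilde{N}(S)\ge 0$ for every nonempty $S\subseteq[m]$.
   Context: $[m]=\{1,\dots,m\}$; a coalition is a nonempty subset of $[m]$. $\|\cdot\|_1$ is the $\ell^1$ norm on $\mathbb{R}^n$. Multistate embedding: for $A\in\mathbb{R}^n$ with coordinates $(A)_1,\dots,(A)_n$, $\psi^{(K)}(A)\in\mathbb{R}_{\ge 0}^{n\times K}$ is given by $[\psi^{(K)}(A)]_{i,k}=|(A)_i|\cdot\mathbf{1}\{(A)_i\in B_k\}$, $i=1,\dots,n$, $k=0,\dots,K-1$. Cumulative intersection of a coalition $S$: $N(S)=\sum_{k=0}^{K-1}\sum_{i=1}^n\min_{j\in S}[\psi^{(K)}(A_j)]_{i,k}$. Exclusive intersection of a coalition $S$ (Möbius inversion): $\widetilde{N}(S)=\sum_{T:\,S\subseteq T\subseteq[m]}(-1)^{|T|-|S|}N(T)$. *)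

theory Defs
  imports "HOL-Analysis.Analysis"
begin

definition l1_norm :: "real ^ 'n \<Rightarrow> real" where
  "l1_norm x = (\<Sum>i\<in>UNIV. \<bar>x $ i\<bar>)"

definition coalition :: "nat \<Rightarrow> nat set \<Rightarrow> bool" where
  "coalition m S \<longleftrightarrow> S \<noteq> {} \<and> S \<subseteq> {1..m}"

text \<open>The sets need not be nonempty.  Lebesgue measurability is the
  weakest reading of \<open>measurable\<close>; it includes all Borel sets.\<close>

definition measurable_partition :: "nat \<Rightarrow> (nat \<Rightarrow> real set) \<Rightarrow> bool" where
  "measurable_partition K B \<longleftrightarrow>
     (\<forall>k<K. B k \<in> sets lebesgue) \<and>
     disjoint_family_on B {..<K} \<and>
     (\<Union>k<K. B k) = UNIV"

text \<open>The embedding is the matrix of the values of \<open>psi B x\<close> at rows \<open>i :: 'n\<close>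
  and columns \<open>k < K\<close>; only these columns are used below.\<close>

definition psi :: "(nat \<Rightarrow> real set) \<Rightarrow> real ^ 'n \<Rightarrow> 'n \<Rightarrow> nat \<Rightarrow> real" where
  "psi B x i k = \<bar>x $ i\<bar> * indicator (B k) (x $ i)"

text \<open>Meaningful for finite nonempty \<open>S\<close> only, since \<open>Min\<close> is unspecified on the empty set.\<close>

definition cumulative_intersection ::
  "nat \<Rightarrow> (nat \<Rightarrow> real set) \<Rightarrow> (nat \<Rightarrow> real ^ 'n) \<Rightarrow> nat set \<Rightarrow> real" where
  "cumulative_intersection K B A S =
     (\<Sum>k<K. \<Sum>i\<in>UNIV. Min ((\<lambda>j. psi B (A j) i k) ` S))"

definition exclusive_intersection ::
  "nat \<Rightarrow> nat \<Rightarrow> (nat \<Rightarrow> real set) \<Rightarrow> (nat \<Rightarrow> real ^ 'n) \<Rightarrow> nat set \<Rightarrow> real" where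
  "exclusive_intersection m K B A S =
     (\<Sum>T | S \<subseteq> T \<and> T \<subseteq> {1..m}.
        (-1) ^ (card T - card S) * cumulative_intersection K B A T)"

end

theory Submission
  imports Defs
begin

text \<open>Everything reduces to the recursion
  \<open>D g S (R \<union> {r}) = D g S R - D g (S \<union> {r}) R\<close> for the alternating sum \<open>D g S R\<close> of
  \<open>g (S \<union> U)\<close> over \<open>U \<subseteq> R\<close>, of which the exclusive intersection of \<open>S\<close> is the case
  where \<open>R\<close> is the complement of \<open>S\<close>. Adding over all the ways to move a part of
  \<open>R\<close> into \<open>S\<close>, the recursion telescopes to \<open>g S\<close>, which is Moebius inversion; at \<open>S = {j}\<close> it
  gives the cumulative intersection of \<open>{j}\<close>, which is the norm of \<open>A\<^sub>j\<close>. When \<open>g\<close> is the minimum of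
  a nonnegative function \<open>f\<close>, the recursion yields the closed form
  \<open>max 0 (min\<^sub>S f - max\<^sub>R f)\<close>, hence nonnegativity entry by entry.\<close>

definition alternating_sum :: "('a set \<Rightarrow> real) \<Rightarrow> 'a set \<Rightarrow> 'a set \<Rightarrow> real" where
  "alternating_sum g S R = (\<Sum>U\<in>Pow R. (-1) ^ card U * g (S \<union> U))"

lemma sum_Pow_insert:
  fixes h :: "'a set \<Rightarrow> 'b::comm_monoid_add"
  assumes "finite R" "r \<notin> R"
  shows "sum h (Pow (insert r R)) = (\<Sum>U\<in>Pow R. h U + h (insert r U))"
proof -
  have "inj_on (insert r) (Pow R)"
    using assms(2) by (auto simp: inj_on_def)
  moreover have "Pow R \<inter> insert r ` Pow R = {}"
    using assms(2) by auto
  ultimately show ?thesis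
    using assms(1) by (simp add: Pow_insert sum.union_disjoint sum.reindex sum.distrib)
qed

text \<open>Split the subsets of \<open>insert r R\<close> by whether they contain \<open>r\<close>:
  in those that do, \<open>r\<close> flips the sign and can be absorbed into
  \<open>S\<close>.\<close>

lemma alternating_sum_insert:
  assumes "finite R" "r \<notin> R"
  shows "alternating_sum g S (insert r R) = alternating_sum g S R - alternating_sum g (insert r S) R"
proof -
  have "(-1) ^ card (insert r U) * g (S \<union> insert r U) = - ((-1) ^ card U * g (insert r S \<union> U))"
    if "U \<in> Pow R" for U
  proof -
    have "finite U" "r \<notin> U"
      using that assms by (auto intro: finite_subset)
    then show ?thesis by simp
  qed
  then show ?thesis
    unfolding alternating_sum_def sum_Pow_insert[OF assms]
    by (simp add: sum_subtractf)
qed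

lemma sum_alternating_sum:
  assumes "finite R"
  shows "(\<Sum>U\<in>Pow R. alternating_sum g (S \<union> U) (R - U)) = g S"
  using assms
proof (induction R)
  case empty
  then show ?case by (simp add: alternating_sum_def)
next
  case (insert r R)
  \<comment> \<open>By the recursion, the first summand is the right-hand side minus the second
    summand.\<close>
  have "alternating_sum g (S \<union> U) (insert r R - U)
        + alternating_sum g (S \<union> insert r U) (insert r R - insert r U)
        = alternating_sum g (S \<union> U) (R - U)" if "U \<in> Pow R" for U
  proof -
    have "insert r R - U = insert r (R - U)" "insert r R - insert r U = R - U"
      using that insert.hyps by auto
    then show ?thesis
      using insert.hyps by (simp add: alternating_sum_insert)
  qed
  then show ?case
    using insert by (simp add: sum_Pow_insert)
qed

text \<open>The \<open>0\<close> inserted in the maximum only matters for empty \<open>R\<close>.\<close>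

lemma alternating_sum_Min:
  assumes "finite R" "finite S" "S \<noteq> {}" "\<And>j. f j \<ge> 0"
  shows "alternating_sum (\<lambda>T. Min (f ` T)) S R = max 0 (Min (f ` S) - Max (insert 0 (f ` R)))"
  using assms(1-3)
proof (induction R arbitrary: S)
  case empty
  then show ?case using assms(4) by (simp add: alternating_sum_def)
next
  case (insert r R)
  have "Min (f ` insert r S) = min (f r) (Min (f ` S))"
    using insert.prems by simp
  moreover have "Max (insert 0 (f ` insert r R)) = max (f r) (Max (insert 0 (f ` R)))"
    using insert.hyps by (simp add: insert_commute[of 0])
  \<comment> \<open>With \<open>a\<close> the minimum over \<open>S\<close>, \<open>b\<close> the
    maximum over \<open>R\<close> and \<open>0\<close>, and \<open>c = f r\<close>, this is
    \<open>max 0 (a - b) - max 0 (min c a - b) = max 0 (a - max c b)\<close>.\<close>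
  ultimately show ?case
    using insert.hyps insert.prems
    by (simp add: alternating_sum_insert insert.IH del: Min_insert Max_insert image_insert)
qed

text \<open>Linearity in \<open>g\<close> reduces cumulative intersections to single matrix entries,
  where \<open>g\<close> is a minimum.\<close>

lemma alternating_sum_sum:
  "alternating_sum (\<lambda>T. \<Sum>i\<in>I. g i T) S R = (\<Sum>i\<in>I. alternating_sum (g i) S R)"
  unfolding alternating_sum_def by (simp add: sum_distrib_left) (rule sum.swap)

lemma exclusive_intersection_eq_alternating_sum:
  assumes "S \<subseteq> {1..m}"
  shows "exclusive_intersection m K B A S =
    alternating_sum (cumulative_intersection K B A) S ({1..m} - S)"
  unfolding exclusive_intersection_def alternating_sum_def
proof (rule sum.reindex_bij_witness[of _ "\<lambda>U. S \<union> U" "\<lambda>T. T - S"])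
  fix T assume T: "T \<in> {T. S \<subseteq> T \<and> T \<subseteq> {1..m}}"
  have "finite S"
    using assms finite_subset by blast
  then show "(-1) ^ card (T - S) * cumulative_intersection K B A (S \<union> (T - S)) =
      (-1) ^ (card T - card S) * cumulative_intersection K B A T"
    using T by (simp add: card_Diff_subset Un_absorb1)
qed (use assms in auto)

lemma exclusive_intersection_nonneg:
  assumes "coalition m S"
  shows "exclusive_intersection m K B A S \<ge> 0"
proof -
  have S: "S \<noteq> {}" "S \<subseteq> {1..m}" "finite S"
    using assms by (auto simp: coalition_def intro: finite_subset)
  have "psi B (A j) i k \<ge> 0" for i j k
    by (simp add: psi_def)
  then show ?thesis
    using S unfolding exclusive_intersection_eq_alternating_sum[OF S(2)]
      cumulative_intersection_def[abs_def] alternating_sum_sum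
    by (intro sum_nonneg) (simp add: alternating_sum_Min)
qed

text \<open>The value \<open>x $ i\<close> lies in exactly one cell \<open>B k\<close> with
  \<open>k < K\<close>, so only that column contributes.\<close>

lemma sum_psi:
  assumes "measurable_partition K B"
  shows "(\<Sum>k<K. psi B x i k) = \<bar>x $ i\<bar>"
proof -
  have "(\<Sum>k<K. indicator (B k) (x $ i)) = (indicator (\<Union>k<K. B k) (x $ i) :: real)"
    using assms by (intro indicator_UN_disjoint[symmetric]) (auto simp: measurable_partition_def)
  then show ?thesis
    using assms by (simp add: psi_def measurable_partition_def flip: sum_distrib_left)
qed

lemma cumulative_intersection_singleton:
  assumes "measurable_partition K B"
  shows "cumulative_intersection K B A {j} = l1_norm (A j)"
  unfolding cumulative_intersection_def l1_norm_def
  by (subst sum.swap) (simp add: sum_psi[OF assms])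

text \<open>The coalitions containing \<open>j\<close> are the sets \<open>{j} \<union> U\<close>
  with \<open>U \<subseteq> ?R\<close>, and their complements are \<open>?R - U\<close>, so Moebius
  inversion applies at \<open>{j}\<close>.\<close>

lemma sum_exclusive_intersection:
  assumes "j \<in> {1..m}"
  shows "(\<Sum>S | coalition m S \<and> j \<in> S. exclusive_intersection m K B A S) =
    cumulative_intersection K B A {j}"
proof -
  let ?R = "{1..m} - {j}"
  have "(\<Sum>S | coalition m S \<and> j \<in> S. exclusive_intersection m K B A S) =
      (\<Sum>U\<in>Pow ?R. alternating_sum (cumulative_intersection K B A) ({j} \<union> U) (?R - U))"
  proof (rule sum.reindex_bij_witness[of _ "\<lambda>U. {j} \<union> U" "\<lambda>S. S - {j}"])
    fix S assume S: "S \<in> {S. coalition m S \<and> j \<in> S}"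
    then have "{j} \<union> (S - {j}) = S" "?R - (S - {j}) = {1..m} - S" "S \<subseteq> {1..m}"
      by (auto simp: coalition_def)
    then show "alternating_sum (cumulative_intersection K B A) ({j} \<union> (S - {j})) (?R - (S - {j})) =
        exclusive_intersection m K B A S"
      by (simp only: exclusive_intersection_eq_alternating_sum)
  qed (use assms in \<open>auto simp: coalition_def\<close>)
  then show ?thesis
    by (simp only: sum_alternating_sum finite_Diff finite_atLeastAtMost)
qed

theorem proposition4p4:
  fixes m K :: nat
    and B :: "nat \<Rightarrow> real set"
    and A :: "nat \<Rightarrow> real ^ 'n"
  assumes "m \<ge> 1" and "K \<ge> 1"
    and "measurable_partition K B"
  shows "(\<forall>j\<in>{1..m}. l1_norm (A j) =
            (\<Sum>S | coalition m S \<and> j \<in> S. exclusive_intersection m K B A S)) \<and>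
         (\<forall>S. coalition m S \<longrightarrow> exclusive_intersection m K B A S \<ge> 0)"
  using assms(3)
  by (simp add: sum_exclusive_intersection cumulative_intersection_singleton
      exclusive_intersection_nonneg)

end
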